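(* Let $(M,\varphi,\xi,\eta,g)$ be a non-Sasakian contact metric $(\kappa,\mu)$-manifold (so $\kappa<1$), let $\lambda=\sqrt{1-\kappa}$, and let $({\mathcal D}(\lambda),{\mathcal D}(-\lambda))$ be its associated bi-Legendrian structure. Then $({\mathcal D}(\lambda),{\mathcal D}(-\lambda))$ is non-flat (i.e. ${\mathcal D}(\lambda)$ and ${\mathcal D}(-\lambda)$ are not both flat). More precisely, exactly one of the following cases occurs: (I) both ${\mathcal D}(\lambda)$ and ${\mathcal D}(-\lambda)$ are positive definite; (II) ${\mathcal D}(\lambda)$ is positive definite and ${\mathcal D}(-\lambda)$ is negative definite; (III) both ${\mathcal D}(\lambda)$ and ${\mathcal D}(-\lambda)$ are negative definite; (IV) ${\mathcal D}(\lambda)$ is positive definite and ${\mathcal D}(-\lambda)$ is flat; (V) ${\mathcal D}(\lambda)$ is flat and ${\mathcal D}(-\lambda)$ is negative definite. Furthermore, with $I_M=\frac{1-\mu/2}{\sqrt{1-\kappa}}$, the manifold $M$ belongs to class (I), (II), (III), (IV), (V) if and only if $I_M>1$, $-1<I_M<1$, $I_M<-1$, $I_M=1$, $I_M=-1$, respectively.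
   Context: Convention: $2d\eta(X,Y)=X(\eta(Y))-Y(\eta(X))-\eta([X,Y])$. A contact manifold is a $(2n+1)$-dimensional smooth manifold $M$ with a 1-form $\eta$ such that $\eta\wedge(d\eta)^n\neq0$ everywhere; its Reeb vector field $\xi$ is determined by $\eta(\xi)=1$, $i_\xi d\eta=0$. A contact metric structure $(\varphi,\xi,\eta,g)$ consists of $\eta$, its Reeb field $\xi$, a $(1,1)$-tensor field $\varphi$ and a Riemannian metric $g$ with $\varphi^2=-I+\eta\otimes\xi$, $d\eta(X,Y)=g(X,\varphi Y)$, $g(\varphi X,\varphi Y)=g(X,Y)-\eta(X)\eta(Y)$. Put $h=\frac12{\mathcal L}_\xi\varphi$. A contact metric manifold is Sasakian if $R_{XY}\xi=\eta(Y)X-\eta(X)Y$, where $R$ is the Levi-Civita curvature of $g$. It is a contact metric $(\kappa,\mu)$-manifold ($\kappa,\mu\in\mathbb{R}$) if $R_{XY}\xi=\kappa(\eta(Y)X-\eta(X)Y)+\mu(\eta(Y)hX-\eta(X)hY)$ for all vector fields $X,Y$. Known facts: then $\kappa\le1$; $\kappa=1$ implies $h=0$ and Sasakian; if $\kappa<1$ it is not Sasakian, and $TM$ is the orthogonal sum of $\mathbb{R}\xi$ and the eigendistributions ${\mathcal D}(\lambda)$, ${\mathcal D}(-\lambda)$ of $h$ for the eigenvalues $\pm\lambda$, $\lambda=\sqrt{1-\kappa}$, which are integrable and define two Legendre foliations. The pair $({\mathcal D}(\lambda),{\mathcal D}(-\lambda))$ is called the associated bi-Legendrian structure. A Legendre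 foliation ${\mathcal F}$ of $(M^{2n+1},\eta)$ is a foliation whose tangent bundle $T{\mathcal F}$ is an $n$-dimensional subbundle of $\ker\eta$ (on which $d\eta$ then vanishes). Its Pang invariant is the symmetric bilinear form on $T{\mathcal F}$ given by $\Pi_{\mathcal F}(X,X')=-({\mathcal L}_X{\mathcal L}_{X'}\eta)(\xi)=2d\eta([\xi,X],X')$. ${\mathcal F}$ is called flat if $\Pi_{\mathcal F}\equiv0$, positive definite (negative definite) if $\Pi_{\mathcal F}$ is positive (negative) definite. *)

theory Defs
  imports
    "HOL-Analysis.Analysis"
    "HOL-Library.Function_Algebras"
    "HOL-Combinatorics.Permutations"
begin

section \<open>Pointwise vector space structure on functions\<close>

text \<open>Tangent vectors and vector fields are real-valued, respectively vector-valued, functions;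
  the following instance makes linear combinations of them available.\<close>

instantiation "fun" :: (type, real_vector) real_vector
begin

definition scaleR_fun_def: "c *\<^sub>R f = (\<lambda>x. c *\<^sub>R f x)"

instance
  by standard (simp_all add: scaleR_fun_def fun_eq_iff scaleR_add_right scaleR_add_left)

end

section \<open>Smooth manifolds\<close>

primrec Ck_on :: "nat \<Rightarrow> 'e::euclidean_space set \<Rightarrow> ('e \<Rightarrow> 'f::real_normed_vector) \<Rightarrow> bool" where
  "Ck_on 0 S f \<longleftrightarrow> continuous_on S f"
| "Ck_on (Suc k) S f \<longleftrightarrow>
     (\<forall>x\<in>S. f differentiable (at x)) \<and>
     (\<forall>v. Ck_on k S (\<lambda>x. frechet_derivative f (at x) v))"

text \<open>Only used for open \<open>S\<close>.\<close>

definition smooth_on :: "'e::euclidean_space set \<Rightarrow> ('e \<Rightarrow> 'f::real_normed_vector) \<Rightarrow> bool" where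
  "smooth_on S f \<longleftrightarrow> (\<forall>k. Ck_on k S f)"

type_synonym ('a, 'e) chart = "'a set \<times> ('a \<Rightarrow> 'e)"

definition chart :: "('a::topological_space, 'e::euclidean_space) chart \<Rightarrow> bool" where
  "chart c \<longleftrightarrow> (case c of (U, x) \<Rightarrow>
     open U \<and> open (x ` U) \<and> homeomorphism U (x ` U) x (inv_into U x))"

text \<open>A smooth manifold is the whole Hausdorff, second countable space \<open>'a\<close> together with a
  smooth atlas \<open>A\<close>, which need not be maximal; its dimension is \<open>DIM('e)\<close>.\<close>

definition smooth_atlas ::
  "('a::{t2_space,second_countable_topology}, 'e::euclidean_space) chart set \<Rightarrow> bool" where
  "smooth_atlas A \<longleftrightarrow>
     (\<forall>c\<in>A. chart c) \<and>
     (\<Union>(U, x)\<in>A. U) = UNIV \<and>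
     (\<forall>(U, x)\<in>A. \<forall>(V, y)\<in>A. smooth_on (x ` (U \<inter> V)) (y \<circ> inv_into U x))"

definition smooth_fun :: "('a, 'e::euclidean_space) chart set \<Rightarrow> ('a \<Rightarrow> real) \<Rightarrow> bool" where
  "smooth_fun A f \<longleftrightarrow> (\<forall>(U, x)\<in>A. smooth_on (x ` U) (f \<circ> inv_into U x))"

section \<open>Tangent vectors, vector fields and tensor fields\<close>

type_synonym 'a tvec = "('a \<Rightarrow> real) \<Rightarrow> real"
type_synonym 'a vfield = "'a \<Rightarrow> 'a tvec"

text \<open>Tangent vectors at \<open>p\<close> are the derivations at \<open>p\<close> of the algebra of smooth functions. They
  are set to \<open>0\<close> on functions that are not smooth, so that two tangent vectors are equal as soon
  as they agree on smooth functions.\<close>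

definition tangent_space :: "('a, 'e::euclidean_space) chart set \<Rightarrow> 'a \<Rightarrow> 'a tvec set" where
  "tangent_space A p = {v.
     (\<forall>f g. smooth_fun A f \<longrightarrow> smooth_fun A g \<longrightarrow> v (\<lambda>q. f q + g q) = v f + v g) \<and>
     (\<forall>c f. smooth_fun A f \<longrightarrow> v (\<lambda>q. c * f q) = c * v f) \<and>
     (\<forall>f g. smooth_fun A f \<longrightarrow> smooth_fun A g \<longrightarrow>
        v (\<lambda>q. f q * g q) = f p * v g + g p * v f) \<and>
     (\<forall>f. \<not> smooth_fun A f \<longrightarrow> v f = 0)}"

definition dderiv :: "'a vfield \<Rightarrow> ('a \<Rightarrow> real) \<Rightarrow> 'a \<Rightarrow> real" where
  "dderiv X f = (\<lambda>p. X p f)"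

definition vector_fields :: "('a, 'e::euclidean_space) chart set \<Rightarrow> 'a vfield set" where
  "vector_fields A = {X. (\<forall>p. X p \<in> tangent_space A p) \<and>
     (\<forall>f. smooth_fun A f \<longrightarrow> smooth_fun A (dderiv X f))}"

definition fscale :: "('a \<Rightarrow> real) \<Rightarrow> 'a vfield \<Rightarrow> 'a vfield" where
  "fscale f X = (\<lambda>p. f p *\<^sub>R X p)"

definition bracket :: "'a vfield \<Rightarrow> 'a vfield \<Rightarrow> 'a vfield" where
  "bracket X Y = (\<lambda>p f. X p (dderiv Y f) - Y p (dderiv X f))"

definition linear_within :: "'v::real_vector set \<Rightarrow> ('v \<Rightarrow> 'w::real_vector) \<Rightarrow> bool" where
  "linear_within V f \<longleftrightarrow>
     (\<forall>u\<in>V. \<forall>v\<in>V. f (u + v) = f u + f v) \<and> (\<forall>c. \<forall>v\<in>V. f (c *\<^sub>R v) = c *\<^sub>R f v)"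

text \<open>The values of the following tensor fields at \<open>p\<close> are only meaningful on the tangent space
  at \<open>p\<close>.\<close>

type_synonym 'a form1 = "'a \<Rightarrow> 'a tvec \<Rightarrow> real"
type_synonym 'a endo = "'a \<Rightarrow> 'a tvec \<Rightarrow> 'a tvec"
type_synonym 'a bilin = "'a \<Rightarrow> 'a tvec \<Rightarrow> 'a tvec \<Rightarrow> real"

definition form_app :: "'a form1 \<Rightarrow> 'a vfield \<Rightarrow> 'a \<Rightarrow> real" where
  "form_app \<omega> X = (\<lambda>p. \<omega> p (X p))"

definition endo_app :: "'a endo \<Rightarrow> 'a vfield \<Rightarrow> 'a vfield" where
  "endo_app T X = (\<lambda>p. T p (X p))"

definition bilin_app :: "'a bilin \<Rightarrow> 'a vfield \<Rightarrow> 'a vfield \<Rightarrow> 'a \<Rightarrow> real" where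
  "bilin_app b X Y = (\<lambda>p. b p (X p) (Y p))"

definition one_form :: "('a, 'e::euclidean_space) chart set \<Rightarrow> 'a form1 \<Rightarrow> bool" where
  "one_form A \<omega> \<longleftrightarrow>
     (\<forall>p. linear_within (tangent_space A p) (\<omega> p)) \<and>
     (\<forall>X\<in>vector_fields A. smooth_fun A (form_app \<omega> X))"

definition endo_field :: "('a, 'e::euclidean_space) chart set \<Rightarrow> 'a endo \<Rightarrow> bool" where
  "endo_field A T \<longleftrightarrow>
     (\<forall>p. linear_within (tangent_space A p) (T p)) \<and>
     (\<forall>p. T p ` tangent_space A p \<subseteq> tangent_space A p) \<and>
     (\<forall>X\<in>vector_fields A. endo_app T X \<in> vector_fields A)"

definition riemannian_metric :: "('a, 'e::euclidean_space) chart set \<Rightarrow> 'a bilin \<Rightarrow> bool" where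
  "riemannian_metric A g \<longleftrightarrow>
     (\<forall>p. \<forall>u\<in>tangent_space A p. linear_within (tangent_space A p) (g p u)) \<and>
     (\<forall>p. \<forall>u\<in>tangent_space A p. \<forall>v\<in>tangent_space A p. g p u v = g p v u) \<and>
     (\<forall>p. \<forall>u\<in>tangent_space A p. u \<noteq> 0 \<longrightarrow> g p u u > 0) \<and>
     (\<forall>X\<in>vector_fields A. \<forall>Y\<in>vector_fields A. smooth_fun A (bilin_app g X Y))"

text \<open>Lie derivatives. A one-form is here given by its action on vector fields, so that
  \<open>lie_form\<close> can be iterated.\<close>

definition lie_form ::
  "'a vfield \<Rightarrow> ('a vfield \<Rightarrow> 'a \<Rightarrow> real) \<Rightarrow> 'a vfield \<Rightarrow> 'a \<Rightarrow> real" where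
  "lie_form X \<omega> Y = (\<lambda>p. X p (\<omega> Y) - \<omega> (bracket X Y) p)"

definition lie_endo :: "'a vfield \<Rightarrow> 'a endo \<Rightarrow> 'a vfield \<Rightarrow> 'a vfield" where
  "lie_endo X T Y = bracket X (endo_app T Y) - endo_app T (bracket X Y)"

section \<open>Contact manifolds\<close>

text \<open>With the convention \<open>2 d\<eta>(X,Y) = X(\<eta>(Y)) - Y(\<eta>(X)) - \<eta>([X,Y])\<close>.\<close>

definition ext_d :: "'a form1 \<Rightarrow> 'a vfield \<Rightarrow> 'a vfield \<Rightarrow> 'a \<Rightarrow> real" where
  "ext_d \<eta> X Y = (\<lambda>p.
     (X p (form_app \<eta> Y) - Y p (form_app \<eta> X) - form_app \<eta> (bracket X Y) p) / 2)"

text \<open>The form \<open>\<eta> \<and> (d\<eta>)\<^sup>n\<close>, evaluated on \<open>X 0, \<dots>, X (2n)\<close>; that is, the alternation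
  of \<open>\<eta> \<otimes> d\<eta> \<otimes> \<dots> \<otimes> d\<eta>\<close>, which is the normalization of the wedge product that goes
  with the above convention for \<open>d\<close>.\<close>

definition contact_volume :: "nat \<Rightarrow> 'a form1 \<Rightarrow> (nat \<Rightarrow> 'a vfield) \<Rightarrow> 'a \<Rightarrow> real" where
  "contact_volume n \<eta> X p =
     (\<Sum>\<sigma> | \<sigma> permutes {..2 * n}. of_int (sign \<sigma>) * form_app \<eta> (X (\<sigma> 0)) p *
        (\<Prod>i<n. ext_d \<eta> (X (\<sigma> (2 * i + 1))) (X (\<sigma> (2 * i + 2))) p)) / fact (2 * n + 1)"

definition contact_manifold ::
  "('a::{t2_space,second_countable_topology}, 'e::euclidean_space) chart set \<Rightarrow> nat \<Rightarrow>
   'a form1 \<Rightarrow> bool" where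
  "contact_manifold A n \<eta> \<longleftrightarrow>
     smooth_atlas A \<and> DIM('e) = 2 * n + 1 \<and> one_form A \<eta> \<and>
     (\<forall>p. \<exists>X. (\<forall>i. X i \<in> vector_fields A) \<and> contact_volume n \<eta> X p \<noteq> 0)"

definition reeb_field :: "('a, 'e::euclidean_space) chart set \<Rightarrow> 'a form1 \<Rightarrow> 'a vfield \<Rightarrow> bool" where
  "reeb_field A \<eta> \<xi> \<longleftrightarrow>
     \<xi> \<in> vector_fields A \<and>
     (\<forall>p. \<eta> p (\<xi> p) = 1) \<and>
     (\<forall>X\<in>vector_fields A. \<forall>p. ext_d \<eta> \<xi> X p = 0)"

definition contact_metric_manifold ::
  "('a::{t2_space,second_countable_topology}, 'e::euclidean_space) chart set \<Rightarrow> nat \<Rightarrow>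
   'a endo \<Rightarrow> 'a vfield \<Rightarrow> 'a form1 \<Rightarrow> 'a bilin \<Rightarrow> bool" where
  "contact_metric_manifold A n \<phi> \<xi> \<eta> g \<longleftrightarrow>
     contact_manifold A n \<eta> \<and> reeb_field A \<eta> \<xi> \<and> endo_field A \<phi> \<and> riemannian_metric A g \<and>
     (\<forall>p. \<forall>v\<in>tangent_space A p. \<phi> p (\<phi> p v) = - v + \<eta> p v *\<^sub>R \<xi> p) \<and>
     (\<forall>X\<in>vector_fields A. \<forall>Y\<in>vector_fields A. ext_d \<eta> X Y = bilin_app g X (endo_app \<phi> Y)) \<and>
     (\<forall>p. \<forall>u\<in>tangent_space A p. \<forall>v\<in>tangent_space A p.
        g p (\<phi> p u) (\<phi> p v) = g p u v - \<eta> p u * \<eta> p v)"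

definition h_op :: "'a endo \<Rightarrow> 'a vfield \<Rightarrow> 'a vfield \<Rightarrow> 'a vfield" where
  "h_op \<phi> \<xi> X = (1 / 2) *\<^sub>R lie_endo \<xi> \<phi> X"

section \<open>Levi-Civita connection, curvature, and the \<open>(\<kappa>,\<mu>)\<close>-condition\<close>

definition affine_connection ::
  "('a, 'e::euclidean_space) chart set \<Rightarrow> ('a vfield \<Rightarrow> 'a vfield \<Rightarrow> 'a vfield) \<Rightarrow> bool" where
  "affine_connection A nab \<longleftrightarrow>
     (\<forall>X\<in>vector_fields A. \<forall>Y\<in>vector_fields A. nab X Y \<in> vector_fields A) \<and>
     (\<forall>X\<in>vector_fields A. \<forall>X'\<in>vector_fields A. \<forall>Y\<in>vector_fields A.
        nab (X + X') Y = nab X Y + nab X' Y) \<and>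
     (\<forall>f X. \<forall>Y\<in>vector_fields A. smooth_fun A f \<longrightarrow> X \<in> vector_fields A \<longrightarrow>
        nab (fscale f X) Y = fscale f (nab X Y)) \<and>
     (\<forall>X\<in>vector_fields A. \<forall>Y\<in>vector_fields A. \<forall>Y'\<in>vector_fields A.
        nab X (Y + Y') = nab X Y + nab X Y') \<and>
     (\<forall>f. \<forall>X\<in>vector_fields A. \<forall>Y\<in>vector_fields A. smooth_fun A f \<longrightarrow>
        nab X (fscale f Y) = fscale (dderiv X f) Y + fscale f (nab X Y))"

definition levi_civita_connection ::
  "('a, 'e::euclidean_space) chart set \<Rightarrow> 'a bilin \<Rightarrow>
   ('a vfield \<Rightarrow> 'a vfield \<Rightarrow> 'a vfield) \<Rightarrow> bool" where
  "levi_civita_connection A g nab \<longleftrightarrow>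
     affine_connection A nab \<and>
     (\<forall>X\<in>vector_fields A. \<forall>Y\<in>vector_fields A. nab X Y - nab Y X = bracket X Y) \<and>
     (\<forall>X\<in>vector_fields A. \<forall>Y\<in>vector_fields A. \<forall>Z\<in>vector_fields A.
        dderiv X (bilin_app g Y Z) = bilin_app g (nab X Y) Z + bilin_app g Y (nab X Z))"

definition curvature ::
  "('a vfield \<Rightarrow> 'a vfield \<Rightarrow> 'a vfield) \<Rightarrow> 'a vfield \<Rightarrow> 'a vfield \<Rightarrow> 'a vfield \<Rightarrow> 'a vfield" where
  "curvature nab X Y Z = nab X (nab Y Z) - nab Y (nab X Z) - nab (bracket X Y) Z"

text \<open>In the next two definitions \<open>nab\<close> is meant to be the Levi-Civita connection of the metric.\<close>

definition sasakian_curvature ::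
  "('a, 'e::euclidean_space) chart set \<Rightarrow> 'a vfield \<Rightarrow> 'a form1 \<Rightarrow>
   ('a vfield \<Rightarrow> 'a vfield \<Rightarrow> 'a vfield) \<Rightarrow> bool" where
  "sasakian_curvature A \<xi> \<eta> nab \<longleftrightarrow>
     (\<forall>X\<in>vector_fields A. \<forall>Y\<in>vector_fields A.
        curvature nab X Y \<xi> = fscale (form_app \<eta> Y) X - fscale (form_app \<eta> X) Y)"

definition kappa_mu_curvature ::
  "('a, 'e::euclidean_space) chart set \<Rightarrow> 'a endo \<Rightarrow> 'a vfield \<Rightarrow> 'a form1 \<Rightarrow>
   ('a vfield \<Rightarrow> 'a vfield \<Rightarrow> 'a vfield) \<Rightarrow> real \<Rightarrow> real \<Rightarrow> bool" where
  "kappa_mu_curvature A \<phi> \<xi> \<eta> nab \<kappa> \<mu> \<longleftrightarrow>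
     (\<forall>X\<in>vector_fields A. \<forall>Y\<in>vector_fields A.
        curvature nab X Y \<xi> =
          \<kappa> *\<^sub>R (fscale (form_app \<eta> Y) X - fscale (form_app \<eta> X) Y) +
          \<mu> *\<^sub>R (fscale (form_app \<eta> Y) (h_op \<phi> \<xi> X) - fscale (form_app \<eta> X) (h_op \<phi> \<xi> Y)))"

definition sasakian_manifold where
  "sasakian_manifold A n \<phi> \<xi> \<eta> g nab \<longleftrightarrow>
     contact_metric_manifold A n \<phi> \<xi> \<eta> g \<and> levi_civita_connection A g nab \<and>
     sasakian_curvature A \<xi> \<eta> nab"

definition kappa_mu_manifold where
  "kappa_mu_manifold A n \<phi> \<xi> \<eta> g nab \<kappa> \<mu> \<longleftrightarrow>
     contact_metric_manifold A n \<phi> \<xi> \<eta> g \<and> levi_civita_connection A g nab \<and>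
     kappa_mu_curvature A \<phi> \<xi> \<eta> nab \<kappa> \<mu>"

section \<open>Distributions and the Pang invariant\<close>

text \<open>A distribution assigns to every point a set of tangent vectors.\<close>

type_synonym 'a distribution = "'a \<Rightarrow> 'a tvec set"

definition sections :: "('a, 'e::euclidean_space) chart set \<Rightarrow> 'a distribution \<Rightarrow> 'a vfield set" where
  "sections A D = {X \<in> vector_fields A. \<forall>p. X p \<in> D p}"

text \<open>The operator \<open>h\<close> is tensorial, hence induces an endomorphism of each tangent space, namely
  \<open>X p \<mapsto> (h X) p\<close>; every tangent vector is the value of a vector field. The eigenspace of that
  endomorphism is therefore the following set.\<close>

definition eigen_distribution ::
  "('a, 'e::euclidean_space) chart set \<Rightarrow> 'a endo \<Rightarrow> 'a vfield \<Rightarrow> real \<Rightarrow> 'a distribution" where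
  "eigen_distribution A \<phi> \<xi> l p =
     {v. \<exists>X\<in>vector_fields A. X p = v \<and> h_op \<phi> \<xi> X p = l *\<^sub>R v}"

text \<open>The Pang invariant \<open>\<Pi>(X,X') = - (L_X L_X' \<eta>)(\<xi>)\<close>, for sections \<open>X\<close>, \<open>X'\<close> of the tangent
  bundle of a Legendre foliation.\<close>

definition pang :: "'a vfield \<Rightarrow> 'a form1 \<Rightarrow> 'a vfield \<Rightarrow> 'a vfield \<Rightarrow> 'a \<Rightarrow> real" where
  "pang \<xi> \<eta> X X' p = - lie_form X (lie_form X' (form_app \<eta>)) \<xi> p"

definition pang_flat ::
  "('a, 'e::euclidean_space) chart set \<Rightarrow> 'a vfield \<Rightarrow> 'a form1 \<Rightarrow> 'a distribution \<Rightarrow> bool" where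
  "pang_flat A \<xi> \<eta> D \<longleftrightarrow> (\<forall>X\<in>sections A D. \<forall>X'\<in>sections A D. \<forall>p. pang \<xi> \<eta> X X' p = 0)"

definition pang_pos_def ::
  "('a, 'e::euclidean_space) chart set \<Rightarrow> 'a vfield \<Rightarrow> 'a form1 \<Rightarrow> 'a distribution \<Rightarrow> bool" where
  "pang_pos_def A \<xi> \<eta> D \<longleftrightarrow> (\<forall>X\<in>sections A D. \<forall>p. X p \<noteq> 0 \<longrightarrow> pang \<xi> \<eta> X X p > 0)"

definition pang_neg_def ::
  "('a, 'e::euclidean_space) chart set \<Rightarrow> 'a vfield \<Rightarrow> 'a form1 \<Rightarrow> 'a distribution \<Rightarrow> bool" where
  "pang_neg_def A \<xi> \<eta> D \<longleftrightarrow> (\<forall>X\<in>sections A D. \<forall>p. X p \<noteq> 0 \<longrightarrow> pang \<xi> \<eta> X X p < 0)"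

datatype pang_class = Class_I | Class_II | Class_III | Class_IV | Class_V

fun belongs_to_class ::
  "('a, 'e::euclidean_space) chart set \<Rightarrow> 'a vfield \<Rightarrow> 'a form1 \<Rightarrow>
   'a distribution \<Rightarrow> 'a distribution \<Rightarrow> pang_class \<Rightarrow> bool" where
  "belongs_to_class A \<xi> \<eta> D D' Class_I \<longleftrightarrow> pang_pos_def A \<xi> \<eta> D \<and> pang_pos_def A \<xi> \<eta> D'"
| "belongs_to_class A \<xi> \<eta> D D' Class_II \<longleftrightarrow> pang_pos_def A \<xi> \<eta> D \<and> pang_neg_def A \<xi> \<eta> D'"
| "belongs_to_class A \<xi> \<eta> D D' Class_III \<longleftrightarrow> pang_neg_def A \<xi> \<eta> D \<and> pang_neg_def A \<xi> \<eta> D'"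
| "belongs_to_class A \<xi> \<eta> D D' Class_IV \<longleftrightarrow> pang_pos_def A \<xi> \<eta> D \<and> pang_flat A \<xi> \<eta> D'"
| "belongs_to_class A \<xi> \<eta> D D' Class_V \<longleftrightarrow> pang_flat A \<xi> \<eta> D \<and> pang_neg_def A \<xi> \<eta> D'"

end

theory Submission
  imports Defs
begin

text \<open>Let \<open>T X = \<nabla>\<^sub>X \<xi>\<close> and let \<open>L\<close> be the Lie derivative along \<open>\<xi>\<close>. Invariance of \<open>d\<eta>\<close> under \<open>\<xi>\<close>
  gives \<open>T = - \<phi> - \<phi> h\<close>, and since \<open>\<nabla>\<^sub>\<xi> = L + T\<close> and \<open>T \<xi> = 0\<close>, the curvature
  \<open>R(X,\<xi>)\<xi> = - (L T) X - T\<^sup>2 X\<close> can be expressed on \<open>ker \<eta>\<close> by \<open>\<phi>\<close>, \<open>h\<close> and \<open>L h\<close> alone. Comparing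
  this expression with its conjugate by \<open>\<phi>\<close> yields \<open>h\<^sup>2 = 1 - \<kappa>\<close> and
  \<open>\<phi> (L h) = (\<mu> - 2) h - 2 (1 - \<kappa>)\<close> on \<open>ker \<eta>\<close>. Pairing the latter with sections of an eigendistribution
  gives \<open>\<Pi> = 2 (1 - \<mu> / 2 + l) g\<close> on \<open>D(l)\<close>, for \<open>l = \<plusminus>\<lambda>\<close>. Nonzero global sections of \<open>D(l)\<close> are of the
  form \<open>h X + l X\<close>.\<close>

section \<open>Smooth functions and vector fields\<close>

text \<open>Since \<open>S\<close> is open, agreement on \<open>S\<close> is agreement near each of
  its points, so the derivatives agree on \<open>S\<close> and the induction applies to
  them.\<close>

lemma Ck_on_cong:
  assumes "open S" "\<And>x. x \<in> S \<Longrightarrow> f x = g x" "Ck_on k S f"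
  shows "Ck_on k S g"
  using assms(2,3)
proof (induction k arbitrary: f g)
  case 0
  then show ?case by (simp cong: continuous_on_cong)
next
  case (Suc k)
  have D: "(g has_derivative frechet_derivative f (at x)) (at x)" if "x \<in> S" for x
    using Suc.prems that assms(1) frechet_derivative_works
    by (metis Ck_on.simps(2) has_derivative_transform_within_open)
  then have "frechet_derivative f (at x) v = frechet_derivative g (at x) v" if "x \<in> S" for x v
    using frechet_derivative_at[OF D[OF that]] by simp
  then have "Ck_on k S (\<lambda>x. frechet_derivative g (at x) v)" for v
    using Suc.IH[of "\<lambda>x. frechet_derivative f (at x) v"] Suc.prems(2) by simp
  moreover have "g differentiable at x" if "x \<in> S" for x
    using D[OF that] by (rule differentiableI)
  ultimately show ?case by simp
qed

lemma Ck_on_const: "Ck_on k S (\<lambda>x. c)"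
  by (induction k arbitrary: c) simp_all

lemma Ck_on_add:
  assumes "open S" "Ck_on k S f" "Ck_on k S g"
  shows "Ck_on k S (\<lambda>x. f x + g x)"
  using assms(2,3)
proof (induction k arbitrary: f g)
  case 0
  then show ?case by (simp add: continuous_on_add)
next
  case (Suc k)
  have "Ck_on k S (\<lambda>x. frechet_derivative (\<lambda>x. f x + g x) (at x) v)" for v
  proof (rule Ck_on_cong[OF assms(1)])
    show "Ck_on k S (\<lambda>x. frechet_derivative f (at x) v + frechet_derivative g (at x) v)"
      using Suc by simp
    show "frechet_derivative f (at x) v + frechet_derivative g (at x) v =
        frechet_derivative (\<lambda>x. f x + g x) (at x) v" if "x \<in> S" for x
    proof -
      have "(f has_derivative frechet_derivative f (at x)) (at x)"
        "(g has_derivative frechet_derivative g (at x)) (at x)"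
        using Suc.prems that by (simp_all flip: frechet_derivative_works)
      from frechet_derivative_at[OF has_derivative_add[OF this]] show ?thesis
        by (simp add: fun_eq_iff)
    qed
  qed
  with Suc.prems show ?case by auto
qed

lemma Ck_on_scaleR:
  assumes "open S" "Ck_on k S f"
  shows "Ck_on k S (\<lambda>x. c *\<^sub>R f x)"
  using assms(2)
proof (induction k arbitrary: f)
  case 0
  then show ?case by (simp add: continuous_on_scaleR)
next
  case (Suc k)
  have "Ck_on k S (\<lambda>x. frechet_derivative (\<lambda>x. c *\<^sub>R f x) (at x) v)" for v
  proof (rule Ck_on_cong[OF assms(1)])
    show "Ck_on k S (\<lambda>x. c *\<^sub>R frechet_derivative f (at x) v)"
      using Suc by simp
    show "c *\<^sub>R frechet_derivative f (at x) v = frechet_derivative (\<lambda>x. c *\<^sub>R f x) (at x) v"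
      if "x \<in> S" for x
    proof -
      have "(f has_derivative frechet_derivative f (at x)) (at x)"
        using Suc.prems that frechet_derivative_works by auto
      from frechet_derivative_at[OF has_derivative_scaleR_right[OF this, of c]] show ?thesis
        by (simp add: fun_eq_iff)
    qed
  qed
  with Suc.prems show ?case by (auto intro: differentiable_scaleR)
qed

section \<open>Smooth functions on a manifold\<close>

lemma smooth_fun_const: "smooth_fun A (\<lambda>q. c)"
  by (auto simp: smooth_fun_def smooth_on_def o_def Ck_on_const)

lemma smooth_fun_add:
  assumes "smooth_atlas A" "smooth_fun A f" "smooth_fun A g"
  shows "smooth_fun A (\<lambda>q. f q + g q)"
proof -
  have "smooth_on (x ` U) ((\<lambda>q. f q + g q) \<circ> inv_into U x)" if "(U, x) \<in> A" for U x
  proof -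
    have "open (x ` U)"
      using assms(1) that by (auto simp: smooth_atlas_def chart_def)
    moreover have "smooth_on (x ` U) (f \<circ> inv_into U x)" "smooth_on (x ` U) (g \<circ> inv_into U x)"
      using assms(2,3) that by (auto simp: smooth_fun_def)
    ultimately show ?thesis
      by (auto simp: smooth_on_def o_def intro: Ck_on_add)
  qed
  then show ?thesis by (auto simp: smooth_fun_def)
qed

lemma smooth_fun_cmult:
  assumes "smooth_atlas A" "smooth_fun A f"
  shows "smooth_fun A (\<lambda>q. c * f q)"
proof -
  have "smooth_on (x ` U) ((\<lambda>q. c * f q) \<circ> inv_into U x)" if "(U, x) \<in> A" for U x
  proof -
    have "open (x ` U)"
      using assms(1) that by (auto simp: smooth_atlas_def chart_def)
    moreover have "smooth_on (x ` U) (f \<circ> inv_into U x)"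
      using assms(2) that by (auto simp: smooth_fun_def)
    ultimately show ?thesis
      using Ck_on_scaleR[of "x ` U" _ "f \<circ> inv_into U x" c] by (auto simp: smooth_on_def o_def)
  qed
  then show ?thesis by (auto simp: smooth_fun_def)
qed

lemma smooth_fun_diff:
  assumes "smooth_atlas A" "smooth_fun A f" "smooth_fun A g"
  shows "smooth_fun A (\<lambda>q. f q - g q)"
  using smooth_fun_add[OF assms(1,2) smooth_fun_cmult[OF assms(1,3), of "-1"]] by simp

section \<open>Tangent vectors as derivations\<close>

lemma tangent_add:
  assumes "v \<in> tangent_space A p" "smooth_fun A f" "smooth_fun A g"
  shows "v (\<lambda>q. f q + g q) = v f + v g"
  using assms by (auto simp: tangent_space_def)

lemma tangent_cmult:
  assumes "v \<in> tangent_space A p" "smooth_fun A f"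
  shows "v (\<lambda>q. c * f q) = c * v f"
  using assms by (auto simp: tangent_space_def)

lemma tangent_diff:
  assumes "smooth_atlas A" "v \<in> tangent_space A p" "smooth_fun A f" "smooth_fun A g"
  shows "v (\<lambda>q. f q - g q) = v f - v g"
  using tangent_add[OF assms(2,3) smooth_fun_cmult[OF assms(1,4), of "-1"]]
    tangent_cmult[OF assms(2,4), of "-1"] by simp

lemma tangent_const:
  assumes "v \<in> tangent_space A p"
  shows "v (\<lambda>q. c) = 0"
proof -
  have "\<forall>f g. smooth_fun A f \<longrightarrow> smooth_fun A g \<longrightarrow> v (\<lambda>q. f q * g q) = f p * v g + g p * v f"
    using assms by (simp add: tangent_space_def)
  \<comment> \<open>The Leibniz rule for 1 * 1 reads v(1) = 2 v(1).\<close>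
  from this[rule_format, of "\<lambda>q. 1" "\<lambda>q. 1"] have "v (\<lambda>q. 1) = 0"
    using smooth_fun_const by auto
  then show ?thesis
    using tangent_cmult[OF assms smooth_fun_const, of c 1] by simp
qed

lemma tangent_space_plus:
  assumes "u \<in> tangent_space A p" "v \<in> tangent_space A p"
  shows "u + v \<in> tangent_space A p"
  using assms by (auto simp: tangent_space_def algebra_simps)

lemma tangent_space_scaleR:
  assumes "u \<in> tangent_space A p"
  shows "c *\<^sub>R u \<in> tangent_space A p"
  using assms by (auto simp: tangent_space_def scaleR_fun_def algebra_simps)

lemma scaleR_vfield: "(c *\<^sub>R X) p f = c * X p f" for X :: "'a vfield"
  by (simp add: scaleR_fun_def)

section \<open>The vector space of vector fields\<close>

lemma vector_field_at: "X \<in> vector_fields A \<Longrightarrow> X p \<in> tangent_space A p"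
  by (simp add: vector_fields_def)

text \<open>No smoothness of \<open>f\<close> is assumed: tangent vectors vanish on non-smooth
  functions, so the derivative is then the constant 0.\<close>

lemma smooth_dderiv:
  assumes "X \<in> vector_fields A"
  shows "smooth_fun A (dderiv X f)"
proof (cases "smooth_fun A f")
  case False
  then have "dderiv X f = (\<lambda>q. 0)"
    using assms by (auto simp: dderiv_def vector_fields_def tangent_space_def)
  then show ?thesis by (simp add: smooth_fun_const)
qed (use assms in \<open>simp add: vector_fields_def\<close>)

lemma dderiv_plus: "dderiv (X + Y) f = (\<lambda>q. dderiv X f q + dderiv Y f q)"
  by (simp add: dderiv_def)

lemma dderiv_scaleR: "dderiv (c *\<^sub>R X) f = (\<lambda>q. c * dderiv X f q)"
  by (simp add: dderiv_def scaleR_fun_def)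

lemma vector_fields_plus:
  assumes "smooth_atlas A" "X \<in> vector_fields A" "Y \<in> vector_fields A"
  shows "X + Y \<in> vector_fields A"
  using assms by (simp add: vector_fields_def tangent_space_plus dderiv_plus smooth_fun_add)

lemma vector_fields_scaleR:
  assumes "smooth_atlas A" "X \<in> vector_fields A"
  shows "c *\<^sub>R X \<in> vector_fields A"
proof -
  have "(c *\<^sub>R X) p = c *\<^sub>R X p" for p by (simp add: scaleR_fun_def)
  with assms show ?thesis
    by (simp add: vector_fields_def tangent_space_scaleR dderiv_scaleR smooth_fun_cmult)
qed

lemma vector_fields_uminus:
  assumes "smooth_atlas A" "X \<in> vector_fields A"
  shows "- X \<in> vector_fields A"
  using vector_fields_scaleR[OF assms, of "-1"] by simp

lemma vector_fields_diff:
  assumes "smooth_atlas A" "X \<in> vector_fields A" "Y \<in> vector_fields A"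
  shows "X - Y \<in> vector_fields A"
  using vector_fields_plus[OF assms(1,2) vector_fields_uminus[OF assms(1,3)]] by simp

section \<open>The Lie bracket\<close>

lemma bracket_swap: "bracket Y X = - bracket X Y"
  by (simp add: bracket_def fun_eq_iff)

lemma bracket_plus_right:
  assumes "X \<in> vector_fields A" "Y \<in> vector_fields A" "Z \<in> vector_fields A"
  shows "bracket X (Y + Z) = bracket X Y + bracket X Z"
  using assms by (simp add: bracket_def fun_eq_iff dderiv_plus
      tangent_add[OF vector_field_at smooth_dderiv smooth_dderiv])

lemma bracket_scaleR_right:
  assumes "X \<in> vector_fields A" "Y \<in> vector_fields A"
  shows "bracket X (c *\<^sub>R Y) = c *\<^sub>R bracket X Y"
  using assms by (simp add: bracket_def fun_eq_iff dderiv_scaleR scaleR_vfield right_diff_distrib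
      tangent_cmult[OF vector_field_at smooth_dderiv])

lemma dderiv_bracket:
  "dderiv (bracket X Y) f = (\<lambda>q. dderiv X (dderiv Y f) q - dderiv Y (dderiv X f) q)"
  by (simp add: dderiv_def bracket_def)

lemma bracket_Jacobi:
  assumes "smooth_atlas A" "X \<in> vector_fields A" "Y \<in> vector_fields A" "Z \<in> vector_fields A"
  shows "bracket X (bracket Y Z) = bracket (bracket X Y) Z + bracket Y (bracket X Z)"
  unfolding fun_eq_iff
proof (intro allI)
  fix p f
  note d = tangent_diff[OF assms(1) vector_field_at smooth_dderiv smooth_dderiv]
  show "bracket X (bracket Y Z) p f = (bracket (bracket X Y) Z + bracket Y (bracket X Z)) p f"
    using assms(2-4) unfolding bracket_def[of X "bracket Y Z"]
      bracket_def[of "bracket X Y" Z] bracket_def[of Y "bracket X Z"]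
    by (simp add: dderiv_bracket d) (simp add: bracket_def)
qed

text \<open>\<open>algebra_simps\<close> can write a double as a product with the constant function
  2; this turns it back into a scalar multiple.\<close>

lemma two_times_vfield: "2 * X = 2 *\<^sub>R X" for X :: "'a vfield"
  by (simp only: mult_2 scaleR_2)

lemma fscale_zero: "fscale f 0 = 0"
  by (simp add: fscale_def fun_eq_iff scaleR_fun_def)

section \<open>Contact metric manifolds\<close>

locale contact_metric =
  fixes A :: "('a::{t2_space,second_countable_topology}, 'e::euclidean_space) chart set"
    and n :: nat
    and \<phi> :: "'a endo" and \<xi> :: "'a vfield" and \<eta> :: "'a form1" and g :: "'a bilin"
    and nab :: "'a vfield \<Rightarrow> 'a vfield \<Rightarrow> 'a vfield"
  assumes cm: "contact_metric_manifold A n \<phi> \<xi> \<eta> g"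
    and lc: "levi_civita_connection A g nab"
begin

abbreviation "V \<equiv> vector_fields A"
abbreviation "L \<equiv> bracket \<xi>"
abbreviation "F \<equiv> endo_app \<phi>"
abbreviation "H \<equiv> h_op \<phi> \<xi>"
abbreviation "G \<equiv> bilin_app g"
abbreviation "E \<equiv> form_app \<eta>"

text \<open>The global sections of the contact distribution, on which \<phi>^2 = -1 holds without
  the Reeb term.\<close>

definition K :: "'a vfield set" where
  "K = {X \<in> V. \<forall>p. E X p = 0}"

lemma atlas: "smooth_atlas A"
  using cm by (simp add: contact_metric_manifold_def contact_manifold_def)

lemmas V_closed [simp] =
  vector_fields_plus[OF atlas] vector_fields_diff[OF atlas]
  vector_fields_uminus[OF atlas] vector_fields_scaleR[OF atlas]

lemma eta_form: "one_form A \<eta>" and reeb: "reeb_field A \<eta> \<xi>" and endo: "endo_field A \<phi>"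
  and metric: "riemannian_metric A g" and connection: "affine_connection A nab"
  using cm lc by (simp_all add: contact_metric_manifold_def contact_manifold_def
      levi_civita_connection_def)

lemma xi_V [simp]: "\<xi> \<in> V"
  using reeb by (simp add: reeb_field_def)

lemma nab_V [simp]: "X \<in> V \<Longrightarrow> Y \<in> V \<Longrightarrow> nab X Y \<in> V"
  using connection by (simp add: affine_connection_def)

lemma torsion_free: "X \<in> V \<Longrightarrow> Y \<in> V \<Longrightarrow> nab X Y - nab Y X = bracket X Y"
  using lc by (simp add: levi_civita_connection_def)

text \<open>Closure under the bracket is read off from the Levi-Civita connection, which is
  torsion-free and maps fields to fields.\<close>

lemma bracket_V [simp]: "X \<in> V \<Longrightarrow> Y \<in> V \<Longrightarrow> bracket X Y \<in> V"
  by (simp flip: torsion_free)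

lemma F_V [simp]: "X \<in> V \<Longrightarrow> F X \<in> V"
  using endo by (simp add: endo_field_def)

lemma H_V [simp]: "X \<in> V \<Longrightarrow> H X \<in> V"
  by (simp add: h_op_def lie_endo_def)

lemma smooth_E: "X \<in> V \<Longrightarrow> smooth_fun A (E X)"
  using eta_form by (simp add: one_form_def)

lemma smooth_G: "X \<in> V \<Longrightarrow> Y \<in> V \<Longrightarrow> smooth_fun A (G X Y)"
  using metric by (simp add: riemannian_metric_def)

lemma V_at [simp]: "X \<in> V \<Longrightarrow> X p \<in> tangent_space A p"
  by (rule vector_field_at)

lemma scaleR_at: "(c *\<^sub>R X) p = c *\<^sub>R X p" for X :: "'a vfield"
  by (simp add: scaleR_fun_def)

section \<open>Linearity of the operators and bilinearity of the metric\<close>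

lemma E_plus: "X \<in> V \<Longrightarrow> Y \<in> V \<Longrightarrow> E (X + Y) p = E X p + E Y p"
  and E_scaleR: "X \<in> V \<Longrightarrow> E (c *\<^sub>R X) p = c * E X p"
  using eta_form by (simp_all add: one_form_def linear_within_def form_app_def scaleR_at)

lemma E_uminus: "X \<in> V \<Longrightarrow> E (- X) p = - E X p"
  using E_scaleR[of X "-1"] by simp

lemma E_diff: "X \<in> V \<Longrightarrow> Y \<in> V \<Longrightarrow> E (X - Y) p = E X p - E Y p"
  using E_plus[of X "- Y"] E_uminus[of Y] by simp

lemmas E_linear = E_plus E_scaleR E_uminus E_diff

lemma F_plus: "X \<in> V \<Longrightarrow> Y \<in> V \<Longrightarrow> F (X + Y) = F X + F Y"
  and F_scaleR: "X \<in> V \<Longrightarrow> F (c *\<^sub>R X) = c *\<^sub>R F X"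
  using endo
  by (auto simp: endo_field_def linear_within_def endo_app_def scaleR_at intro!: ext[where 'a='a])

lemma F_uminus: "X \<in> V \<Longrightarrow> F (- X) = - F X"
  using F_scaleR[of X "-1"] by simp

lemma F_diff: "X \<in> V \<Longrightarrow> Y \<in> V \<Longrightarrow> F (X - Y) = F X - F Y"
  using F_plus[of X "- Y"] F_uminus[of Y] by simp

lemmas F_linear = F_plus F_scaleR F_uminus F_diff

lemma L_plus: "X \<in> V \<Longrightarrow> Y \<in> V \<Longrightarrow> L (X + Y) = L X + L Y"
  by (rule bracket_plus_right) simp_all

lemma L_scaleR: "X \<in> V \<Longrightarrow> L (c *\<^sub>R X) = c *\<^sub>R L X"
  by (rule bracket_scaleR_right) simp_all

lemma L_uminus: "X \<in> V \<Longrightarrow> L (- X) = - L X"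
  using L_scaleR[of X "-1"] by simp

lemma L_diff: "X \<in> V \<Longrightarrow> Y \<in> V \<Longrightarrow> L (X - Y) = L X - L Y"
  using L_plus[of X "- Y"] L_uminus[of Y] by simp

lemmas L_linear = L_plus L_scaleR L_uminus L_diff

lemma H_eq: "H X = (1 / 2) *\<^sub>R (L (F X) - F (L X))"
  by (simp add: h_op_def lie_endo_def)

lemma LF_eq: "L (F X) = F (L X) + 2 *\<^sub>R H X"
  by (simp add: H_eq)

lemma H_plus: "X \<in> V \<Longrightarrow> Y \<in> V \<Longrightarrow> H (X + Y) = H X + H Y"
  by (simp add: H_eq F_linear L_linear scaleR_right_distrib scaleR_right_diff_distrib)

lemma H_scaleR: "X \<in> V \<Longrightarrow> H (c *\<^sub>R X) = c *\<^sub>R H X"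
  by (simp add: H_eq F_linear L_linear scaleR_right_diff_distrib scaleR_left_commute)

lemma H_uminus: "X \<in> V \<Longrightarrow> H (- X) = - H X"
  using H_scaleR[of X "-1"] by simp

lemma H_diff: "X \<in> V \<Longrightarrow> Y \<in> V \<Longrightarrow> H (X - Y) = H X - H Y"
  using H_plus[of X "- Y"] H_uminus[of Y] by simp

lemmas H_linear = H_plus H_scaleR H_uminus H_diff

lemma G_commute: "X \<in> V \<Longrightarrow> Y \<in> V \<Longrightarrow> G X Y p = G Y X p"
  using metric by (simp add: riemannian_metric_def bilin_app_def)

lemma G_plus_right: "X \<in> V \<Longrightarrow> Y \<in> V \<Longrightarrow> Z \<in> V \<Longrightarrow> G X (Y + Z) p = G X Y p + G X Z p"
  and G_scaleR_right: "X \<in> V \<Longrightarrow> Y \<in> V \<Longrightarrow> G X (c *\<^sub>R Y) p = c * G X Y p"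
  using metric
  by (simp_all add: riemannian_metric_def linear_within_def bilin_app_def scaleR_at)

lemma G_uminus_right: "X \<in> V \<Longrightarrow> Y \<in> V \<Longrightarrow> G X (- Y) p = - G X Y p"
  using G_scaleR_right[of X Y "-1"] by simp

lemma G_diff_right: "X \<in> V \<Longrightarrow> Y \<in> V \<Longrightarrow> Z \<in> V \<Longrightarrow> G X (Y - Z) p = G X Y p - G X Z p"
  using G_plus_right[of X Y "- Z"] G_uminus_right[of X Z] by simp

lemma G_plus_left: "X \<in> V \<Longrightarrow> Y \<in> V \<Longrightarrow> Z \<in> V \<Longrightarrow> G (Y + Z) X p = G Y X p + G Z X p"
  using G_plus_right[of X Y Z] by (simp add: G_commute[of _ X])

lemma G_scaleR_left: "X \<in> V \<Longrightarrow> Y \<in> V \<Longrightarrow> G (c *\<^sub>R Y) X p = c * G Y X p"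
  using G_scaleR_right[of X Y] by (simp add: G_commute[of _ X])

lemma G_uminus_left: "X \<in> V \<Longrightarrow> Y \<in> V \<Longrightarrow> G (- Y) X p = - G Y X p"
  using G_uminus_right[of X Y] by (simp add: G_commute[of _ X])

lemma G_diff_left: "X \<in> V \<Longrightarrow> Y \<in> V \<Longrightarrow> Z \<in> V \<Longrightarrow> G (Y - Z) X p = G Y X p - G Z X p"
  using G_diff_right[of X Y Z] by (simp add: G_commute[of _ X])

lemmas G_bilinear = G_plus_right G_scaleR_right G_uminus_right G_diff_right
  G_plus_left G_scaleR_left G_uminus_left G_diff_left

lemma G_pos: "X \<in> V \<Longrightarrow> X p \<noteq> 0 \<Longrightarrow> G X X p > 0"
  using metric by (simp add: riemannian_metric_def bilin_app_def)

lemma G_self_eq_0D: "X \<in> V \<Longrightarrow> G X X p = 0 \<Longrightarrow> X p = 0"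
  using G_pos[of X p] by force

lemma G_self_nonneg: "X \<in> V \<Longrightarrow> G X X p \<ge> 0"
proof (cases "X p = 0")
  case True
  assume "X \<in> V"
  with True show ?thesis
    using G_scaleR_right[of X X 0 p] by (simp add: bilin_app_def)
qed (use G_pos in force)

lemma metric_compatible:
  assumes "X \<in> V" "Y \<in> V" "Z \<in> V"
  shows "X p (G Y Z) = G (nab X Y) Z p + G Y (nab X Z) p"
proof -
  have "dderiv X (G Y Z) = G (nab X Y) Z + G Y (nab X Z)"
    using lc assms by (simp add: levi_civita_connection_def)
  from fun_cong[OF this, of p] show ?thesis by (simp add: dderiv_def)
qed

section \<open>The Reeb field, \<phi> and the contact form\<close>

lemma ext_d_eq_G: "X \<in> V \<Longrightarrow> Y \<in> V \<Longrightarrow> ext_d \<eta> X Y = G X (F Y)"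
  using cm by (simp add: contact_metric_manifold_def)

lemma E_xi: "E \<xi> = (\<lambda>p. 1)"
  using reeb by (simp add: reeb_field_def form_app_def)

text \<open>This is the invariance of \<eta> under \<xi>: in d\<eta>(\<xi>, X) = 0 the term
  X(\<eta>(\<xi>)) is the derivative of the constant 1.\<close>

lemma E_L: "X \<in> V \<Longrightarrow> E (L X) = dderiv \<xi> (E X)"
proof
  fix p
  assume X: "X \<in> V"
  then have "ext_d \<eta> \<xi> X p = 0"
    using reeb by (simp add: reeb_field_def)
  with X show "E (L X) p = dderiv \<xi> (E X) p"
    by (simp add: ext_d_def E_xi tangent_const[OF V_at] dderiv_def)
qed

lemma KI: "X \<in> V \<Longrightarrow> (\<And>p. E X p = 0) \<Longrightarrow> X \<in> K"
  by (simp add: K_def)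

lemma ext_d_skew:
  assumes "X \<in> V" "Y \<in> V"
  shows "ext_d \<eta> X Y p = - ext_d \<eta> Y X p"
proof -
  have "E (bracket X Y) p = - E (bracket Y X) p"
    using assms by (simp add: bracket_swap[of X Y] E_uminus)
  then show ?thesis by (simp add: ext_d_def field_simps)
qed

lemma K_V [simp]: "X \<in> K \<Longrightarrow> X \<in> V"
  and E_K [simp]: "X \<in> K \<Longrightarrow> E X p = 0"
  by (simp_all add: K_def)

lemma K_linear [simp]:
  "X \<in> K \<Longrightarrow> Y \<in> K \<Longrightarrow> X + Y \<in> K" "X \<in> K \<Longrightarrow> Y \<in> K \<Longrightarrow> X - Y \<in> K"
  "X \<in> K \<Longrightarrow> - X \<in> K" "X \<in> K \<Longrightarrow> c *\<^sub>R X \<in> K"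
  by (auto intro!: KI simp: E_linear)

lemma F_F: "X \<in> V \<Longrightarrow> F (F X) = - X + fscale (E X) \<xi>"
  using cm by (auto simp: contact_metric_manifold_def endo_app_def fscale_def form_app_def
      intro!: ext[where 'a='a])

lemma F_F_K [simp]: "X \<in> K \<Longrightarrow> F (F X) = - X"
  by (simp add: F_F fscale_def fun_eq_iff scaleR_fun_def)

text \<open>The squared norm of \<phi>\<xi> is d\<eta>(\<phi>\<xi>, \<xi>), which vanishes by the
  Reeb condition.\<close>

lemma F_xi: "F \<xi> = 0"
proof
  fix p
  have "G (F \<xi>) (F \<xi>) p = ext_d \<eta> (F \<xi>) \<xi> p"
    by (simp add: ext_d_eq_G)
  also have "\<dots> = - ext_d \<eta> \<xi> (F \<xi>) p"
    by (simp add: ext_d_skew[of "F \<xi>"])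
  also have "\<dots> = 0"
    using reeb by (simp add: reeb_field_def)
  finally have "F \<xi> p = 0"
    by (rule G_self_eq_0D[rotated]) simp
  then show "F \<xi> p = 0 p"
    by (simp add: zero_fun_def)
qed

lemma G_F_F: "X \<in> V \<Longrightarrow> Y \<in> V \<Longrightarrow> G (F X) (F Y) p = G X Y p - E X p * E Y p"
  using cm by (simp add: contact_metric_manifold_def bilin_app_def endo_app_def form_app_def)

lemma G_zero [simp]: "X \<in> V \<Longrightarrow> G X 0 p = 0"
  using G_scaleR_right[of X X 0 p] by simp

text \<open>For Y = \<xi> the compatibility of g with \<phi> becomes 0 = g(X, \<xi>) - \<eta>(X),
  since \<phi>\<xi> = 0.\<close>

lemma G_xi: "X \<in> V \<Longrightarrow> G X \<xi> p = E X p"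
  using G_F_F[of X \<xi> p] by (simp add: F_xi E_xi)

lemma F_skew: "X \<in> V \<Longrightarrow> Y \<in> V \<Longrightarrow> G X (F Y) p = - G (F X) Y p"
proof -
  assume X: "X \<in> V" and Y: "Y \<in> V"
  have "G X (F Y) p = - ext_d \<eta> Y X p"
    using X Y ext_d_skew[OF X Y] by (simp add: ext_d_eq_G)
  with X Y show ?thesis by (simp add: ext_d_eq_G G_commute)
qed

text \<open>\<eta>(\<phi>X) = g(\<phi>X, \<xi>) = -g(X, \<phi>\<xi>) = 0.\<close>

lemma F_K [simp]: "X \<in> V \<Longrightarrow> F X \<in> K"
  using F_skew[of X \<xi>] by (auto intro!: KI simp: F_xi G_xi)

lemma L_K [simp]:
  assumes "X \<in> K"
  shows "L X \<in> K"
proof (rule KI)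
  have "E X = (\<lambda>q. 0)"
    using assms by (simp add: fun_eq_iff)
  then show "E (L X) p = 0" for p
    using assms by (simp add: E_L dderiv_def tangent_const[OF V_at])
qed (use assms in simp)

lemma xi_E: "X \<in> V \<Longrightarrow> \<xi> p (E X) = E (L X) p"
  by (simp add: E_L dderiv_def)

text \<open>\<open>L\<^sub>\<xi> d\<eta> = 0\<close>, which follows from \<open>i\<^sub>\<xi> d\<eta> = 0\<close> by the Jacobi identity.\<close>

lemma xi_deta:
  assumes X: "X \<in> V" and Y: "Y \<in> V"
  shows "\<xi> p (G X (F Y)) = G (L X) (F Y) p + G X (F (L Y)) p"
proof -
  \<comment> \<open>The three terms of 2 d\<eta>(X, Y) are named because \<xi> may be distributed
    over a difference only when its terms are known to be smooth.\<close>
  define a where "a = dderiv X (E Y)"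
  define b where "b = dderiv Y (E X)"
  define c where "c = E (bracket X Y)"
  have smooth: "smooth_fun A a" "smooth_fun A b" "smooth_fun A c"
    using X Y by (simp_all add: a_def b_def c_def smooth_dderiv smooth_E)
  have "G X (F Y) = (\<lambda>q. (1 / 2) * (a q - b q - c q))"
    using X Y by (simp add: a_def b_def c_def ext_d_def dderiv_def fun_eq_iff flip: ext_d_eq_G)
  then have "\<xi> p (G X (F Y)) = (1 / 2) * \<xi> p (\<lambda>q. a q - b q - c q)"
    by (simp only:) (rule tangent_cmult[OF V_at[OF xi_V] smooth_fun_diff[OF atlas
        smooth_fun_diff[OF atlas smooth(1,2)] smooth(3)]])
  also have "\<xi> p (\<lambda>q. a q - b q - c q) = \<xi> p (\<lambda>q. a q - b q) - \<xi> p c"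
    by (rule tangent_diff[OF atlas V_at[OF xi_V] smooth_fun_diff[OF atlas smooth(1,2)] smooth(3)])
  also have "\<xi> p (\<lambda>q. a q - b q) = \<xi> p a - \<xi> p b"
    by (rule tangent_diff[OF atlas V_at[OF xi_V] smooth(1,2)])
  finally have 1: "\<xi> p (G X (F Y)) =
      (1 / 2) * (\<xi> p (dderiv X (E Y)) - \<xi> p (dderiv Y (E X)) - \<xi> p (E (bracket X Y)))"
    by (simp only: a_def b_def c_def)
  have 2: "E (L (bracket X Y)) p = E (bracket (L X) Y) p + E (bracket X (L Y)) p"
    using X Y by (simp add: bracket_Jacobi[OF atlas xi_V X Y] E_plus)
  have 3: "2 * G (L X) (F Y) p = \<xi> p (dderiv X (E Y)) - X p (dderiv \<xi> (E Y))
      - Y p (dderiv \<xi> (E X)) - E (bracket (L X) Y) p"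
    using X Y by (simp add: ext_d_def E_L flip: ext_d_eq_G) (simp add: bracket_def)
  have 4: "2 * G X (F (L Y)) p = X p (dderiv \<xi> (E Y)) - (\<xi> p (dderiv Y (E X))
      - Y p (dderiv \<xi> (E X))) - E (bracket X (L Y)) p"
    using X Y by (simp add: ext_d_def E_L flip: ext_d_eq_G) (simp add: bracket_def)
  \<comment> \<open>In the sum of \<open>3\<close> and \<open>4\<close> the terms
    X(\<xi>(\<eta>(Y))) and Y(\<xi>(\<eta>(X))) cancel; \<open>2\<close> and \<open>5\<close>
    identify the rest with \<open>1\<close>.\<close>
  have 5: "\<xi> p (E (bracket X Y)) = E (L (bracket X Y)) p"
    using X Y by (simp add: xi_E)
  show ?thesis using 1 2 3 4 5 by argo
qed

section \<open>Symmetries of h and the Lie derivative of the metric\<close>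

lemma H_K [simp]: "X \<in> V \<Longrightarrow> H X \<in> K"
  by (simp add: H_eq)

text \<open>The Lie derivative of \<phi>^2 = -1 along \<xi> gives h\<phi> + \<phi>h = 0 on ker
  \<eta>.\<close>

lemma H_F: "X \<in> K \<Longrightarrow> H (F X) = - F (H X)"
  by (simp add: H_eq F_linear L_linear scaleR_right_diff_distrib scaleR_right_distrib)

text \<open>The Lie derivative of g along \<xi> is -2 g(X, \<phi>hZ). It comes from the invariance
  of d\<eta> applied to the pair X, \<phi>Z, because d\<eta>(X, \<phi>Z) = -g(X, Z).\<close>

lemma xi_metric:
  assumes X: "X \<in> V" and Z: "Z \<in> K"
  shows "\<xi> p (G X Z) = G (L X) Z p + G X (L Z) p - 2 * G X (F (H Z)) p"
proof -
  have "G X (F (F Z)) = (\<lambda>q. -1 * G X Z q)"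
    using X Z by (simp add: fun_eq_iff G_bilinear)
  then have "\<xi> p (G X (F (F Z))) = - \<xi> p (G X Z)"
    using tangent_cmult[OF V_at[OF xi_V] smooth_G[OF X K_V[OF Z]], of p "-1"] by simp
  moreover have "\<xi> p (G X (F (F Z))) = G (L X) (F (F Z)) p + G X (F (L (F Z))) p"
    using X Z by (intro xi_deta) simp_all
  ultimately show ?thesis
    using X Z by (simp add: LF_eq F_linear G_bilinear)
qed

text \<open>The Lie derivative of g is computed a second time, now from g(X, Y) = d\<eta>(\<phi>X,
  Y). This puts \<phi>h on the other argument, and comparison with \<open>xi_metric\<close> gives
  the symmetry.\<close>

lemma FH_symmetric:
  assumes X: "X \<in> V" and Y: "Y \<in> K"
  shows "G (F (H X)) Y p = G X (F (H Y)) p"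
proof -
  have "G (F X) (F Y) = G X Y"
    using X Y by (simp add: fun_eq_iff G_F_F)
  then have "\<xi> p (G X Y) = G (L (F X)) (F Y) p + G (F X) (F (L Y)) p"
    using xi_deta[of "F X" Y p] X Y by simp
  moreover have "G (L (F X)) (F Y) p = G (L X) Y p - 2 * G (F (H X)) Y p"
    using X Y by (simp add: LF_eq G_bilinear G_F_F F_skew[of "H X" Y])
  ultimately show ?thesis
    using xi_metric[OF X Y, of p] X Y by (simp add: G_F_F)
qed

text \<open>Symmetry of \<phi>h for the pair X, \<phi>Y, with \<phi> moved past h by anticommutation
  and then removed.\<close>

lemma H_symmetric:
  assumes X: "X \<in> V" and Y: "Y \<in> K"
  shows "G (H X) Y p = G X (H Y) p"
  using FH_symmetric[of X "F Y" p] X Y by (simp add: G_F_F H_F F_linear G_bilinear)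

text \<open>The form g(\<nabla>\<xi>, -) is determined by its symmetric part, half the Lie
  derivative of g, and its skew part, d\<eta>. The difference \<open>W\<close> of the two sides is
  thus orthogonal to \<open>K\<close>; as it lies in \<open>K\<close>, it vanishes.\<close>

lemma nab_xi:
  assumes X: "X \<in> V"
  shows "nab X \<xi> = - F X - F (H X)"
proof -
  define W where "W = nab X \<xi> + F X + F (H X)"
  have W: "W \<in> K"
  \<comment> \<open>Differentiating g(\<xi>, \<xi>) = 1 along X shows that \<nabla>\<xi> takes
    values in ker \<eta>.\<close>
  proof -
    have "G \<xi> \<xi> = (\<lambda>p. 1)"
      by (simp add: fun_eq_iff G_xi E_xi)
    then have "E (nab X \<xi>) p = 0" for p
      using metric_compatible[OF X xi_V xi_V, of p] X
      by (simp add: tangent_const[OF V_at] G_commute[of \<xi>] G_xi)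
    then have "nab X \<xi> \<in> K"
      using X by (intro KI) simp_all
    with X show ?thesis by (simp add: W_def)
  qed
  have "G W Z p = 0" if Z: "Z \<in> K" for Z p
  proof -
    have E_G: "E Y = G Y \<xi>" if "Y \<in> V" for Y
      using that by (simp add: fun_eq_iff G_xi)
    have nab_comm: "nab Y Y' = nab Y' Y + bracket Y Y'" if "Y \<in> V" "Y' \<in> V" for Y Y'
      using torsion_free[OF that] by (simp add: algebra_simps)
    \<comment> \<open>Symmetric part: the two covariant derivatives along \<xi> are exchanged for
      brackets plus derivatives of \<xi>.\<close>
    have a: "\<xi> p (G X Z) = G (L X) Z p + G (nab X \<xi>) Z p + (G X (L Z) p + G X (nab Z \<xi>) p)"
      using X Z metric_compatible[of \<xi> X Z p] nab_comm[of \<xi> X] nab_comm[of \<xi> Z]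
      by (simp add: G_bilinear)
    \<comment> \<open>Skew part: \<eta> is written as g(-, \<xi>), and metric compatibility leaves
      only derivatives of \<xi>.\<close>
    have "2 * G X (F Z) p = X p (G Z \<xi>) - Z p (G X \<xi>) - G (bracket X Z) \<xi> p"
      using X Z by (simp add: ext_d_def E_G flip: ext_d_eq_G)
    also have "\<dots> = G Z (nab X \<xi>) p - G X (nab Z \<xi>) p"
      using X Z metric_compatible[of X Z \<xi> p] metric_compatible[of Z X \<xi> p] nab_comm[of X Z]
      by (simp add: G_bilinear)
    finally have b: "2 * G X (F Z) p = G (nab X \<xi>) Z p - G X (nab Z \<xi>) p"
      using X Z by (simp add: G_commute[of Z])
    show ?thesis
      using a b xi_metric[OF X Z, of p] FH_symmetric[OF X Z, of p] F_skew[of X Z p] X Z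
      by (simp add: W_def G_bilinear)
  qed
  with W have "W = 0"
    using G_self_eq_0D[of W] by (simp add: fun_eq_iff[where 'a='a] zero_fun_def)
  then show ?thesis
    by (simp add: W_def algebra_simps eq_neg_iff_add_eq_0)
qed

lemma H_xi: "H \<xi> = 0"
proof -
  have "L \<xi> = 0" by (simp add: bracket_def fun_eq_iff)
  moreover have "F 0 = 0" "L 0 = 0"
    using F_scaleR[of \<xi> 0] L_scaleR[of \<xi> 0] by simp_all
  ultimately show ?thesis by (simp add: H_eq F_xi)
qed

end

section \<open>The \<open>(\<kappa>,\<mu>)\<close>-condition and the Pang invariant\<close>

locale kappa_mu = contact_metric +
  fixes \<kappa> \<mu> :: real
  assumes km: "kappa_mu_curvature A \<phi> \<xi> \<eta> nab \<kappa> \<mu>"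
begin

text \<open>Both sides are R(X, \<xi>)\<xi>. On the left, \<xi> is geodesic, so only the terms with
  \<nabla> along \<xi> and along [X, \<xi>] remain; \<open>nab_xi\<close> turns them into \<phi>, h
  and brackets. On the right is the curvature condition for \<eta>(X) = 0.\<close>

lemma curvature_xi:
  assumes X: "X \<in> K"
  shows "X + 2 *\<^sub>R H X + H (H X) + F (L (H X) - H (L X)) = \<kappa> *\<^sub>R X + \<mu> *\<^sub>R H X"
proof -
  have nab_add: "nab Y (Z + Z') = nab Y Z + nab Y Z'" if "Y \<in> V" "Z \<in> V" "Z' \<in> V" for Y Z Z'
    using connection that by (simp add: affine_connection_def)
  have zero: "0 \<in> V" using V_closed(2)[of \<xi> \<xi>] by simp
  have nab_0: "nab X 0 = 0"
    using nab_add[OF _ zero zero, of X] X by simp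
  have nab_xi_xi: "nab \<xi> \<xi> = 0"
    using F_scaleR[of \<xi> 0] by (simp add: nab_xi F_xi H_xi)
  have nab_xi_left: "nab \<xi> Y = L Y - F Y - F (H Y)" if "Y \<in> V" for Y
    using torsion_free[OF xi_V that] nab_xi[OF that] by (simp add: algebra_simps)
  have "curvature nab X \<xi> \<xi> = - nab \<xi> (- F X - F (H X)) + F (bracket X \<xi>) + F (H (bracket X \<xi>))"
    using X by (simp add: curvature_def nab_xi_xi nab_0 nab_xi)
  also have "bracket X \<xi> = - L X" by (rule bracket_swap)
  also have "- nab \<xi> (- F X - F (H X)) + F (- L X) + F (H (- L X)) =
      X + 2 *\<^sub>R H X + H (H X) + F (L (H X) - H (L X))"
    using X by (simp add: nab_xi_left F_linear H_linear L_linear H_F LF_eq scaleR_2)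
  finally have "curvature nab X \<xi> \<xi> = X + 2 *\<^sub>R H X + H (H X) + F (L (H X) - H (L X))" .
  moreover have "curvature nab X \<xi> \<xi> = \<kappa> *\<^sub>R (fscale (E \<xi>) X - fscale (E X) \<xi>) +
      \<mu> *\<^sub>R (fscale (E \<xi>) (H X) - fscale (E X) (H \<xi>))"
    using km X by (simp add: kappa_mu_curvature_def)
  moreover have "fscale (E \<xi>) Y = Y" "fscale (E X) Y = 0" for Y
    using X by (simp_all add: fscale_def E_xi fun_eq_iff scaleR_fun_def)
  ultimately show ?thesis by simp
qed

text \<open>The difference of \<open>curvature_xi\<close> and its conjugate by \<open>\<phi>\<close> gives \<open>h\<^sup>2\<close>, their sum gives
  \<open>\<phi> (L h)\<close>.\<close>

lemma
  assumes X: "X \<in> K"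
  shows H_H: "H (H X) = (1 - \<kappa>) *\<^sub>R X"
    and F_lie_H: "F (L (H X) - H (L X)) = (\<mu> - 2) *\<^sub>R H X - (2 * (1 - \<kappa>)) *\<^sub>R X"
proof -
  \<comment> \<open>This is the Lie derivative of h\<phi> + \<phi>h = 0: each of the two terms in
    which \<phi> is differentiated contributes 2 h^2.\<close>
  have lie: "L (H (F X)) - H (L (F X)) = - F (L (H X)) + F (H (L X)) - 4 *\<^sub>R H (H X)"
    using X by (simp add: LF_eq H_F L_linear H_linear)
      (simp add: algebra_simps two_times_vfield)
  have "F (F X + 2 *\<^sub>R H (F X) + H (H (F X)) + F (L (H (F X)) - H (L (F X)))) =
      F (\<kappa> *\<^sub>R F X + \<mu> *\<^sub>R H (F X))"
    using curvature_xi[of "F X"] X by simp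
  \<comment> \<open>The coefficient 3 is 4 from \<open>lie\<close> minus 1 from \<phi>h^2\<phi> =
    -h^2, whence the splitting of 4 as 1 + 3.\<close>
  moreover have "F (F X + 2 *\<^sub>R H (F X) + H (H (F X)) + F (L (H (F X)) - H (L (F X)))) =
      - X + 2 *\<^sub>R H X + 3 *\<^sub>R H (H X) + F (L (H X) - H (L X))"
    unfolding lie using X scaleR_add_left[of 1 3 "H (H X)"]
    by (simp add: F_linear H_F H_linear)
  moreover have "F (\<kappa> *\<^sub>R F X + \<mu> *\<^sub>R H (F X)) = - \<kappa> *\<^sub>R X + \<mu> *\<^sub>R H X"
    using X by (simp add: F_linear H_F)
  ultimately have 2: "- X + 2 *\<^sub>R H X + 3 *\<^sub>R H (H X) + F (L (H X) - H (L X)) =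
      - \<kappa> *\<^sub>R X + \<mu> *\<^sub>R H X"
    by (simp only:)
  note 1 = curvature_xi[OF X]
  \<comment> \<open>Equations \<open>1\<close> and \<open>2\<close> form a linear system for h^2 X
    and the \<phi>-image of the Lie derivative of h, solved here value by value.\<close>
  have pt: "H (H X) p f = (1 - \<kappa>) * X p f \<and>
    F (L (H X) - H (L X)) p f = (\<mu> - 2) * H X p f - 2 * (1 - \<kappa>) * X p f" for p f
    using fun_cong[OF fun_cong[OF 1], of p f] fun_cong[OF fun_cong[OF 2], of p f]
    by (simp add: scaleR_vfield algebra_simps)
  show "H (H X) = (1 - \<kappa>) *\<^sub>R X"
    "F (L (H X) - H (L X)) = (\<mu> - 2) *\<^sub>R H X - (2 * (1 - \<kappa>)) *\<^sub>R X"
    unfolding fun_eq_iff using pt by (simp_all add: scaleR_vfield)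
qed

section \<open>Eigensections of h and their Pang invariant\<close>

lemma section_eigen:
  assumes "X \<in> sections A (eigen_distribution A \<phi> \<xi> l)" "l \<noteq> 0"
  shows "X \<in> K" "H X = l *\<^sub>R X"
proof -
  have X: "X \<in> V" using assms by (simp add: sections_def)
  have "H X p = l *\<^sub>R X p" for p
  proof -
    obtain Z where Z: "Z \<in> V" "Z p = X p" "H Z p = l *\<^sub>R X p"
      using assms by (auto simp: sections_def eigen_distribution_def)
    \<comment> \<open>Membership in the eigenspace at \<open>p\<close> is witnessed by some field
      \<open>Z\<close> depending on \<open>p\<close>. That h X and h Z agree at \<open>p\<close>
      follows from symmetry: g(W, W) = g(X - Z, hW), and X - Z vanishes at \<open>p\<close>.\<close>
    define W where "W = H (X - Z)"
    have W: "W \<in> K" using X Z by (simp add: W_def)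
    have "G (X - Z) (H W) p = G ((0::real) *\<^sub>R X) (H W) p"
      using Z by (simp add: bilin_app_def)
    also have "\<dots> = 0" using G_scaleR_left[of "H W" X 0 p] X W by simp
    finally have "G W W p = 0"
      using H_symmetric[of "X - Z" W p] X Z W by (simp add: W_def)
    then have "W p = 0" using W by (intro G_self_eq_0D) simp_all
    with X Z show ?thesis by (simp add: W_def H_linear)
  qed
  then show H: "H X = l *\<^sub>R X"
    by (simp add: fun_eq_iff[where 'a='a] scaleR_at)
  \<comment> \<open>The image of h lies in \<open>K\<close>, so a nonzero eigenvalue forces X itself
    into \<open>K\<close>.\<close>
  have "l *\<^sub>R X \<in> K" using X H_K[of X] by (simp add: H)
  from K_linear(4)[OF this, of "1 / l"] show "X \<in> K"
    using assms(2) by simp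
qed

text \<open>First \<Pi>(X, Y) = 2 g([\<xi>, X], \<phi>Y); then \<open>F_lie_H\<close> applied to X
  is paired with Y.\<close>

lemma pang_eq:
  assumes l: "l\<^sup>2 = 1 - \<kappa>" "l \<noteq> 0"
    and X: "X \<in> sections A (eigen_distribution A \<phi> \<xi> l)"
    and Y: "Y \<in> sections A (eigen_distribution A \<phi> \<xi> l)"
  shows "pang \<xi> \<eta> X Y p = 2 * (1 - \<mu> / 2 + l) * G X Y p"
proof -
  note X = section_eigen[OF X l(2)] and Y = section_eigen[OF Y l(2)]
  have E0: "E Z = (\<lambda>q. 0)" if "Z \<in> K" for Z
    using that by (simp add: fun_eq_iff)
  have br: "bracket Z \<xi> = - L Z" for Z by (rule bracket_swap)
  \<comment> \<open>The inner Lie derivative of \<eta> vanishes on \<xi> because [\<xi>, Y] stays in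
    ker \<eta>.\<close>
  have "lie_form Y E \<xi> = (\<lambda>q. 0)"
    using Y by (simp add: lie_form_def br E_xi tangent_const[OF V_at] fun_eq_iff)
  then have "pang \<xi> \<eta> X Y p = - E (bracket Y (- L (X))) p"
    using X Y by (simp add: pang_def lie_form_def[of X] br tangent_const[OF V_at])
      (simp add: lie_form_def E0 tangent_const[OF V_at])
  also have "\<dots> = 2 * ext_d \<eta> Y (- L X) p"
    using X Y by (simp add: ext_d_def E0 tangent_const[OF V_at])
  also have "\<dots> = 2 * G (L X) (F Y) p"
    using X Y by (simp add: ext_d_eq_G F_linear G_bilinear F_skew[of Y] G_commute[of "F Y"])
  finally have pang: "pang \<xi> \<eta> X Y p = 2 * G (L X) (F Y) p" .
  have "l * ((\<mu> - 2) - 2 * l) * G X Y p = G ((\<mu> - 2) *\<^sub>R H X - (2 * (1 - \<kappa>)) *\<^sub>R X) Y p"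
    using X Y by (simp add: G_bilinear power2_eq_square algebra_simps flip: l(1))
  also have "\<dots> = G (F (L (H X) - H (L X))) Y p"
    using X(1) by (simp only: F_lie_H)
  also have "\<dots> = - G (l *\<^sub>R L X - H (L X)) (F Y) p"
    using X Y by (simp add: F_skew L_linear)
  also have "\<dots> = - l * G (L X) (F Y) p + G (L X) (H (F Y)) p"
    using X Y H_symmetric[of "L X" "F Y" p] by (simp add: G_bilinear)
  \<comment> \<open>\<phi>Y is an eigenvector for -l, so the second term doubles the first.\<close>
  also have "\<dots> = l * (- 2 * G (L X) (F Y) p)"
    using X Y by (simp add: H_F F_linear G_bilinear)
  finally have "((\<mu> - 2) - 2 * l) * G X Y p = - 2 * G (L X) (F Y) p"
    using l(2) by (simp only: mult.assoc mult_cancel_left) blast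
  then show ?thesis
    unfolding pang by (simp add: algebra_simps)
qed

text \<open>If \<open>K\<close> were trivial, every field would be a multiple of \<xi> and h would
  vanish. The right-hand sides of the (\<kappa>,\<mu>)-condition and of the Sasakian condition would
  then both be 0.\<close>

lemma ex_nonzero_K:
  assumes "\<not> sasakian_curvature A \<xi> \<eta> nab"
  shows "\<exists>X\<in>K. \<exists>p. X p \<noteq> 0"
proof (rule ccontr)
  assume "\<not> ?thesis"
  then have K0: "X = 0" if "X \<in> K" for X
    using that by (auto simp: zero_fun_def)
  have X: "X = fscale (E X) \<xi>" if "X \<in> V" for X
  proof -
    have "F (F X) = 0" using that by (intro K0) simp
    then show ?thesis using F_F[OF that] by simp
  qed
  have "fscale (E Y) X = fscale (E X) Y" if "X \<in> V" "Y \<in> V" for X Y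
    using fun_cong[OF X[OF that(1)]] fun_cong[OF X[OF that(2)]]
    by (auto simp: fscale_def fun_eq_iff[where 'a='a])
  moreover have "H X = 0" if "X \<in> V" for X
    using that by (simp add: K0)
  ultimately have "sasakian_curvature A \<xi> \<eta> nab"
    using km by (simp add: sasakian_curvature_def kappa_mu_curvature_def fscale_zero)
  with assms show False by contradiction
qed

text \<open>On \<open>K\<close> the squared norm of hY is (1 - \<kappa>) times that of Y, which
  gives \<kappa> \<le> 1. If \<kappa> = 1 then h = 0, and the curvature condition becomes the
  Sasakian one.\<close>

lemma kappa_less_1:
  assumes "\<not> sasakian_curvature A \<xi> \<eta> nab"
  shows "\<kappa> < 1"
proof -
  obtain X p where X: "X \<in> K" "X p \<noteq> 0"
    using ex_nonzero_K[OF assms] by blast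
  have norm_H: "G (H Y) (H Y) p = (1 - \<kappa>) * G Y Y p" if "Y \<in> K" for Y p
    using that H_symmetric[of Y "H Y" p] by (simp add: H_H G_bilinear)
  have "(1 - \<kappa>) * G X X p \<ge> 0"
    using norm_H[OF X(1), of p] G_self_nonneg[of "H X" p] X by simp
  moreover have "G X X p > 0"
    using X by (simp add: G_pos)
  ultimately have "\<kappa> \<le> 1"
    by (simp add: zero_le_mult_iff)
  moreover have "\<kappa> \<noteq> 1"
  proof
    assume 1: "\<kappa> = 1"
    have HK: "H Y p = 0" if "Y \<in> K" for Y p
      using norm_H[OF that, of p] that 1 by (intro G_self_eq_0D) simp_all
    \<comment> \<open>For Y outside \<open>K\<close>, symmetry reduces the claim to h(hY) = 0, where
      hY is already in \<open>K\<close>.\<close>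
    have "H Y = 0" if "Y \<in> V" for Y
    proof
      fix p
      have "H (H Y) = 0"
        using that HK[of "H Y"] by (auto simp: zero_fun_def)
      then have "G (H Y) (H Y) p = 0"
        using that by (simp add: H_symmetric)
      then show "H Y p = 0 p"
        using that G_self_eq_0D[of "H Y" p] by (simp add: zero_fun_def)
    qed
    then have "sasakian_curvature A \<xi> \<eta> nab"
      using km 1 by (simp add: sasakian_curvature_def kappa_mu_curvature_def fscale_zero)
    with assms show False by contradiction
  qed
  ultimately show ?thesis by simp
qed

text \<open>Since h^2 = l^2 on \<open>K\<close>, the operator h + l maps \<open>K\<close> into the
  eigensections for l. It is not zero: h = -l on all of \<open>K\<close> contradicts the
  anticommutation of h with \<phi>.\<close>

lemma ex_nonzero_section:
  assumes "\<not> sasakian_curvature A \<xi> \<eta> nab" and l: "l\<^sup>2 = 1 - \<kappa>" "l \<noteq> 0"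
  shows "\<exists>X\<in>sections A (eigen_distribution A \<phi> \<xi> l). \<exists>p. X p \<noteq> 0"
proof -
  obtain X p where X: "X \<in> K" "X p \<noteq> 0"
    using ex_nonzero_K[OF assms(1)] by blast
  have "H Y + l *\<^sub>R Y \<in> sections A (eigen_distribution A \<phi> \<xi> l)" if "Y \<in> K" for Y
  proof -
    have "H (H Y + l *\<^sub>R Y) = l *\<^sub>R (H Y + l *\<^sub>R Y)"
      using that by (simp add: H_linear H_H scaleR_right_distrib power2_eq_square flip: l(1))
    then have "H (H Y + l *\<^sub>R Y) p = l *\<^sub>R (H Y + l *\<^sub>R Y) p" for p
      by (simp add: scaleR_at)
    moreover have "H Y + l *\<^sub>R Y \<in> V"
      using that by simp
    ultimately show ?thesis
      unfolding sections_def eigen_distribution_def by blast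
  qed
  moreover have "\<exists>Y\<in>K. H Y + l *\<^sub>R Y \<noteq> 0"
  proof (rule ccontr)
    assume "\<not> ?thesis"
    then have H: "H Y = - (l *\<^sub>R Y)" if "Y \<in> K" for Y
      using that by (simp add: eq_neg_iff_add_eq_0)
    have "l *\<^sub>R F X = - (l *\<^sub>R F X)"
      using H_F[OF X(1)] X(1) by (simp add: H F_linear)
    then have "2 *\<^sub>R l *\<^sub>R F X = 0"
      unfolding scaleR_2 by (simp only: eq_neg_iff_add_eq_0)
    then have "F X = 0" using l(2) by simp
    then have "F (F X) = 0" using F_scaleR[of X 0] X by simp
    then have "X = 0" using X by simp
    then show False using X by (simp add: zero_fun_def)
  qed
  ultimately obtain W where "W \<in> sections A (eigen_distribution A \<phi> \<xi> l)" "W \<noteq> 0"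
    by blast
  moreover from \<open>W \<noteq> 0\<close> have "\<exists>p. W p \<noteq> 0"
    by (auto simp: fun_eq_iff zero_fun_def)
  ultimately show ?thesis by blast
qed

text \<open>The Pang invariant is a constant multiple of g, so the sign of the constant decides. A
  nonzero section is needed for the converse directions, as otherwise all three properties would
  hold vacuously.\<close>

lemma pang_sign:
  assumes "\<not> sasakian_curvature A \<xi> \<eta> nab" and l: "l\<^sup>2 = 1 - \<kappa>" "l \<noteq> 0"
  defines "D \<equiv> eigen_distribution A \<phi> \<xi> l"
  shows "pang_flat A \<xi> \<eta> D \<longleftrightarrow> 1 - \<mu> / 2 + l = 0"
    and "pang_pos_def A \<xi> \<eta> D \<longleftrightarrow> 1 - \<mu> / 2 + l > 0"
    and "pang_neg_def A \<xi> \<eta> D \<longleftrightarrow> 1 - \<mu> / 2 + l < 0"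
proof -
  define c where "c = 2 * (1 - \<mu> / 2 + l)"
  have pang: "pang \<xi> \<eta> X Y p = c * G X Y p" if "X \<in> sections A D" "Y \<in> sections A D" for X Y p
    using pang_eq[OF l] that by (simp add: D_def c_def)
  have pos: "G X X p > 0" if "X \<in> sections A D" "X p \<noteq> 0" for X p
    using that by (simp add: sections_def G_pos)
  obtain X p where X: "X \<in> sections A D" "X p \<noteq> 0"
    using ex_nonzero_section[OF assms(1-3)] by (auto simp: D_def)
  have c: "c = 0 \<longleftrightarrow> 1 - \<mu> / 2 + l = 0" "c > 0 \<longleftrightarrow> 1 - \<mu> / 2 + l > 0"
      "c < 0 \<longleftrightarrow> 1 - \<mu> / 2 + l < 0"
    by (auto simp: c_def)
  show "pang_flat A \<xi> \<eta> D \<longleftrightarrow> 1 - \<mu> / 2 + l = 0"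
    unfolding pang_flat_def c[symmetric] using X pos[OF X] by (force simp: pang)
  show "pang_pos_def A \<xi> \<eta> D \<longleftrightarrow> 1 - \<mu> / 2 + l > 0"
    unfolding pang_pos_def_def c[symmetric] using X pos pos[OF X]
    by (force simp: pang zero_less_mult_iff)
  show "pang_neg_def A \<xi> \<eta> D \<longleftrightarrow> 1 - \<mu> / 2 + l < 0"
    unfolding pang_neg_def_def c[symmetric] using X pos pos[OF X]
    by (force simp: pang mult_less_0_iff)
qed

end

theorem theorem3p1:
  fixes A :: "('a::{t2_space,second_countable_topology}, 'e::euclidean_space) chart set"
    and n :: nat
    and \<phi> :: "'a endo" and \<xi> :: "'a vfield" and \<eta> :: "'a form1" and g :: "'a bilin"
    and nab :: "'a vfield \<Rightarrow> 'a vfield \<Rightarrow> 'a vfield"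
    and \<kappa> \<mu> :: real
  assumes "kappa_mu_manifold A n \<phi> \<xi> \<eta> g nab \<kappa> \<mu>"
    and "\<not> sasakian_manifold A n \<phi> \<xi> \<eta> g nab"
  shows "let ev = sqrt (1 - \<kappa>);
             D = eigen_distribution A \<phi> \<xi> ev;
             D' = eigen_distribution A \<phi> \<xi> (- ev);
             I\<^sub>M = (1 - \<mu> / 2) / sqrt (1 - \<kappa>)
         in \<kappa> < 1 \<and>
            \<not> (pang_flat A \<xi> \<eta> D \<and> pang_flat A \<xi> \<eta> D') \<and>
            (\<exists>!c. belongs_to_class A \<xi> \<eta> D D' c) \<and>
            (belongs_to_class A \<xi> \<eta> D D' Class_I \<longleftrightarrow> I\<^sub>M > 1) \<and>
            (belongs_to_class A \<xi> \<eta> D D' Class_II \<longleftrightarrow> - 1 < I\<^sub>M \<and> I\<^sub>M < 1) \<and>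
            (belongs_to_class A \<xi> \<eta> D D' Class_III \<longleftrightarrow> I\<^sub>M < - 1) \<and>
            (belongs_to_class A \<xi> \<eta> D D' Class_IV \<longleftrightarrow> I\<^sub>M = 1) \<and>
            (belongs_to_class A \<xi> \<eta> D D' Class_V \<longleftrightarrow> I\<^sub>M = - 1)"
proof -
  interpret kappa_mu A n \<phi> \<xi> \<eta> g nab \<kappa> \<mu>
    using assms(1) by unfold_locales (simp_all add: kappa_mu_manifold_def)
  have nS: "\<not> sasakian_curvature A \<xi> \<eta> nab"
    using assms(2) cm lc by (simp add: sasakian_manifold_def)
  define l where "l = sqrt (1 - \<kappa>)"
  define m where "m = 1 - \<mu> / 2"
  have \<kappa>: "\<kappa> < 1" by (rule kappa_less_1[OF nS])
  then have l: "l > 0" "l\<^sup>2 = 1 - \<kappa>" "(- l)\<^sup>2 = 1 - \<kappa>" "l \<noteq> 0" "- l \<noteq> 0"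
    by (simp_all add: l_def)
  \<comment> \<open>The two distributions are governed by the signs of \<open>m + l\<close> and
    \<open>m - l\<close>.\<close>
  note signs = pang_sign[OF nS l(2,4), folded m_def] pang_sign[OF nS l(3,5), folded m_def]
  have "(\<exists>!c. belongs_to_class A \<xi> \<eta> (eigen_distribution A \<phi> \<xi> l)
      (eigen_distribution A \<phi> \<xi> (- l)) c)"
    (is "\<exists>!c. ?B c")
  proof -
    \<comment> \<open>As l > 0, \<open>m - l\<close> is less than \<open>m + l\<close>, which leaves
      exactly five sign patterns.\<close>
    have "?B Class_I \<or> ?B Class_II \<or> ?B Class_III \<or> ?B Class_IV \<or> ?B Class_V"
      using l(1) by (auto simp: signs)
    moreover have "c = c'" if "?B c" "?B c'" for c c'
      using that l(1) by (cases c; cases c') (auto simp: signs)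
    ultimately show ?thesis by blast
  qed
  moreover have "m / l > 1 \<longleftrightarrow> m > l" "m / l < 1 \<longleftrightarrow> m < l" "- 1 < m / l \<longleftrightarrow> - l < m"
      "m / l < - 1 \<longleftrightarrow> m < - l" "m / l = 1 \<longleftrightarrow> m = l" "m / l = - 1 \<longleftrightarrow> m = - l"
    using l(1) by (auto simp: field_simps)
  ultimately show ?thesis
    unfolding Let_def l_def[symmetric] m_def[symmetric]
    using l(1) \<kappa> by (auto simp: signs)
qed

end
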